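(* Let $X\subset\mathbb{Z}^2$ be a thick convex digital disk with bounding curve $S$, where $S$ is a bounding curve with respect to which $X$ is convex and thick. Let $B_1$ be the set of points $x\in S$ such that $x$ is an endpoint of a maximal slanted edge in $S$. Let $B_2$ be the union of the maximal horizontal and maximal vertical line segments in $S$. Let $B=B_1\cup B_2$. Then $B$ is a minimal freezing set for $(X,c_2)$.
   Context: Adjacencies. Distinct points $x=(x_1,x_2)$, $y=(y_1,y_2)$ of $\mathbb{Z}^2$ are $c_1$-adjacent if they differ by exactly 1 in exactly one coordinate and agree in the other (4-adjacency); they are $c_2$-adjacent if they differ by at most 1 in each coordinate (8-adjacency). Write $x\leftrightarrow_{\kappa}y$ for $\kappa$-adjacency, $\kappa\in\{c_1,c_2\}$. A $\kappa$-path is a finite sequence in which consecutive points are equal or $\kappa$-adjacent. A set $Y$ is $\kappa$-connected if any two of its points are joined by a $\kappa$-path in $Y$; $\kappa$-components are maximal $\kappa$-connected subsets. Continuity and freezing sets. For $X\subset\mathbb{Z}^2$, a function $f:X\to X$ is $\kappa$-continuous, written $f\in C(X,\kappa)$, if $f(A)$ is $\kappa$-connected for every $\kappa$-connected $A\subset X$ (equivalently, $x\leftrightarrow_\kappa x'$ in $X$ implies that $f(x)$ and $f(x')$ are equal or $\kappa$-adjacent). $\mathrm{Fix}(f)=\{x\in X: f(x)=x\}$. A set $A\subset X$ is a freezing set for $(X,\kappa)$ if for every $f\in C(X,\kappa)$, $A\subset \mathrm{Fix}(f)$ implies $f=\mathrm{id}_X$. It is a minimal freezing set if moreover no proper subset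 of $A$ is a freezing set for $(X,\kappa)$ (equivalently, $A\setminus\{p\}$ is not a freezing set for any $p\in A$). Boundary and interior. $Bd(X)=\{x\in X:\text{ there is } y\in\mathbb{Z}^2\setminus X \text{ with } y\leftrightarrow_{c_1}x\}$ and $Int(X)=X\setminus Bd(X)$. Curves and disks. A digital line segment is a $c_2$-connected set of collinear points of $\mathbb{Z}^2$; it is horizontal, vertical, or slanted (slope $\pm1$). A $c_2$-closed curve is a $c_2$-path $\{s_i\}_{i=0}^{m-1}$, $m\ge 3$, with $s_0=s_{m-1}$ and $s_i\ne s_j$ whenever $0<|i-j|<m-1$. The line segments (edges, sides) of such a curve are the digital line segments with at least two points formed by (cyclically) consecutive points of the curve; maximal means maximal under inclusion among these. If $S$ is a $c_2$-closed curve such that $\mathbb{Z}^2\setminus S$ has exactly two $c_1$-components, one finite and the other infinite, then the union $D$ of $S$ and the finite $c_1$-component is a digital disk, and $S$ is a bounding curve of $D$. Convexity. For finite $Y\subset\mathbb{Z}^2$, $hull(Y)\subset\mathbb{R}^2$ is its Euclidean convex hull. A digital disk $X$ is convex if it has a bounding curve $S$ such that the endpoints of the maximal line segments of $S$ are the vertices of the polygon $hull(X)$; then $X$ is said to be convex with respect to $S$. Interior angles. Let $s_1,s_2$ be sides of $X$, i.e. maximal line segments of a bounding curve $S$ of $X$, with $s_1\cap s_2=\{p\}$. The interior angle of $X$ (of $S$) at $p$ is the angle formed by $s_1$, $s_2$ and $Int(X)$: if there is $q\in X\setminus(s_1\cup s_2)$ with $q\leftrightarrow_{c_2}p$, it is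 the angle obtained by rotating $s_1$ about $p$ through $q$ to reach $s_2$; otherwise it is the $45^\circ$ angle determined by $s_1$ and $s_2$. Thickness. A digital disk $X$ is thick if for some bounding curve $S$ of $X$ (then $X$ is thick with respect to $S$) both of the following hold: (1) for every slanted segment $s$ of $Bd(X)$, if $p\in s$ is not an endpoint of $s$, then there exists $c\in X$, not on the line containing $s$, such that $c\leftrightarrow_{c_2}p$ and $c$ is not $c_1$-adjacent to $p$ (so $c$ is the diagonal neighbor of $p$ in a direction perpendicular to $s$); (2) if $p$ is the vertex of a $135^\circ$ interior angle $\theta$ of $S$, then there exist $b,b'\in X$ in the interior of $\theta$ such that $b\leftrightarrow_{c_2}p$, $b$ is not $c_1$-adjacent to $p$, and $b'\leftrightarrow_{c_1}p$. *)

theory Defs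
  imports "HOL-Analysis.Analysis"
begin

type_synonym point = "int \<times> int"

section \<open>Adjacency, connectedness, continuity, freezing sets\<close>

definition c1_adj :: "point \<Rightarrow> point \<Rightarrow> bool" where
  "c1_adj p q \<longleftrightarrow>
     (\<bar>fst p - fst q\<bar> = 1 \<and> snd p = snd q) \<or> (fst p = fst q \<and> \<bar>snd p - snd q\<bar> = 1)"

definition c2_adj :: "point \<Rightarrow> point \<Rightarrow> bool" where
  "c2_adj p q \<longleftrightarrow> p \<noteq> q \<and> \<bar>fst p - fst q\<bar> \<le> 1 \<and> \<bar>snd p - snd q\<bar> \<le> 1"

text \<open>An adjacency, written \<open>\<kappa>\<close>, is passed as a parameter; it is always \<open>c1_adj\<close> or \<open>c2_adj\<close>.\<close>

definition dpath :: "(point \<Rightarrow> point \<Rightarrow> bool) \<Rightarrow> point list \<Rightarrow> bool" where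
  "dpath \<kappa> ps \<longleftrightarrow> ps \<noteq> [] \<and> (\<forall>i. Suc i < length ps \<longrightarrow> ps ! i = ps ! Suc i \<or> \<kappa> (ps ! i) (ps ! Suc i))"

definition dconnected :: "(point \<Rightarrow> point \<Rightarrow> bool) \<Rightarrow> point set \<Rightarrow> bool" where
  "dconnected \<kappa> Y \<longleftrightarrow>
     (\<forall>x\<in>Y. \<forall>y\<in>Y. \<exists>ps. dpath \<kappa> ps \<and> set ps \<subseteq> Y \<and> hd ps = x \<and> last ps = y)"

definition dcomponents :: "(point \<Rightarrow> point \<Rightarrow> bool) \<Rightarrow> point set \<Rightarrow> point set set" where
  "dcomponents \<kappa> Y =
     {C. C \<subseteq> Y \<and> dconnected \<kappa> C \<and> (\<forall>C'. C \<subseteq> C' \<and> C' \<subseteq> Y \<and> dconnected \<kappa> C' \<longrightarrow> C' = C)}"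

definition dcontinuous_maps :: "point set \<Rightarrow> (point \<Rightarrow> point \<Rightarrow> bool) \<Rightarrow> (point \<Rightarrow> point) set" where
  "dcontinuous_maps X \<kappa> =
     {f. f ` X \<subseteq> X \<and> (\<forall>A. A \<subseteq> X \<and> dconnected \<kappa> A \<longrightarrow> dconnected \<kappa> (f ` A))}"

definition Fix_on :: "point set \<Rightarrow> (point \<Rightarrow> point) \<Rightarrow> point set" where
  "Fix_on X f = {x \<in> X. f x = x}"

text \<open>Self-maps of \<open>X\<close> are represented by total functions, so \<open>f = id\<^sub>X\<close> is equality on \<open>X\<close> only.\<close>

definition freezing_set :: "point set \<Rightarrow> (point \<Rightarrow> point \<Rightarrow> bool) \<Rightarrow> point set \<Rightarrow> bool" where
  "freezing_set X \<kappa> A \<longleftrightarrow>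
     A \<subseteq> X \<and> (\<forall>f \<in> dcontinuous_maps X \<kappa>. A \<subseteq> Fix_on X f \<longrightarrow> (\<forall>x\<in>X. f x = x))"

definition minimal_freezing_set :: "point set \<Rightarrow> (point \<Rightarrow> point \<Rightarrow> bool) \<Rightarrow> point set \<Rightarrow> bool" where
  "minimal_freezing_set X \<kappa> A \<longleftrightarrow>
     freezing_set X \<kappa> A \<and> (\<forall>A'. A' \<subset> A \<longrightarrow> \<not> freezing_set X \<kappa> A')"

definition Bd :: "point set \<Rightarrow> point set" where
  "Bd X = {x \<in> X. \<exists>y. y \<notin> X \<and> c1_adj y x}"


section \<open>Digital line segments\<close>

text \<open>The Euclidean plane is taken to be the complex plane, which makes angles available
  through \<^const>\<open>Arg2pi\<close>.\<close>

definition emb :: "point \<Rightarrow> complex" where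
  "emb p = Complex (of_int (fst p)) (of_int (snd p))"

definition digital_segment :: "point set \<Rightarrow> bool" where
  "digital_segment L \<longleftrightarrow> dconnected c2_adj L \<and> collinear (emb ` L)"

definition horizontal :: "point set \<Rightarrow> bool" where
  "horizontal L \<longleftrightarrow> (\<forall>p\<in>L. \<forall>q\<in>L. snd p = snd q)"

definition vertical :: "point set \<Rightarrow> bool" where
  "vertical L \<longleftrightarrow> (\<forall>p\<in>L. \<forall>q\<in>L. fst p = fst q)"

definition slanted :: "point set \<Rightarrow> bool" where
  "slanted L \<longleftrightarrow> (\<forall>p\<in>L. \<forall>q\<in>L. snd p - snd q = fst p - fst q)
                \<or> (\<forall>p\<in>L. \<forall>q\<in>L. snd p - snd q = - (fst p - fst q))"

definition segment_endpoints :: "point set \<Rightarrow> point set" where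
  "segment_endpoints L = {p \<in> L. \<not> (\<exists>q\<in>L. \<exists>r\<in>L. emb p \<in> open_segment (emb q) (emb r))}"


section \<open>Closed curves and digital disks\<close>

text \<open>A closed curve is the list \<open>s\<^sub>0, \<dots>, s\<^bsub>m-1\<^esub>\<close> including the repeated
  point \<open>s\<^sub>0 = s\<^bsub>m-1\<^esub>\<close>; hence indices are cyclic modulo \<open>m - 1\<close>.\<close>

definition closed_curve :: "point list \<Rightarrow> bool" where
  "closed_curve S \<longleftrightarrow> dpath c2_adj S \<and> length S \<ge> 3 \<and> S ! 0 = S ! (length S - 1)
     \<and> (\<forall>i < length S. \<forall>j < length S.
          0 < \<bar>int i - int j\<bar> \<and> \<bar>int i - int j\<bar> < int (length S) - 1 \<longrightarrow> S ! i \<noteq> S ! j)"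

definition curve_segments :: "point list \<Rightarrow> point set set" where
  "curve_segments S = {L. digital_segment L \<and> card L \<ge> 2
     \<and> (\<exists>i k. L = (\<lambda>j. S ! ((i + j) mod (length S - 1))) ` {..k})}"

definition max_segments :: "point list \<Rightarrow> point set set" where
  "max_segments S = {L \<in> curve_segments S. \<forall>L' \<in> curve_segments S. L \<subseteq> L' \<longrightarrow> L' = L}"

definition bounding_curve :: "point list \<Rightarrow> point set \<Rightarrow> bool" where
  "bounding_curve S D \<longleftrightarrow> closed_curve S \<and>
     (\<exists>F I. dcomponents c1_adj (- set S) = {F, I} \<and> finite F \<and> infinite I \<and> D = set S \<union> F)"

definition digital_disk :: "point set \<Rightarrow> bool" where
  "digital_disk D \<longleftrightarrow> (\<exists>S. bounding_curve S D)"


section \<open>Convexity, interior angles, thickness\<close>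

definition convex_wrt :: "point set \<Rightarrow> point list \<Rightarrow> bool" where
  "convex_wrt X S \<longleftrightarrow> bounding_curve S X
     \<and> emb ` (\<Union>L \<in> max_segments S. segment_endpoints L)
         = {v. v extreme_point_of (convex hull (emb ` X))}"

text \<open>The angle swept by rotating the ray \<open>pa\<close> counterclockwise about \<open>p\<close> onto the ray \<open>pb\<close>:
  its measure, a value in \<open>[0, 2\<pi>)\<close>, and its interior, an open sector.\<close>

definition angle_measure :: "point \<Rightarrow> point \<Rightarrow> point \<Rightarrow> real" where
  "angle_measure p a b = Arg2pi ((emb b - emb p) / (emb a - emb p))"

definition angle_interior :: "point \<Rightarrow> point \<Rightarrow> point \<Rightarrow> point set" where
  "angle_interior p a b =
     {q. q \<noteq> p \<and> 0 < angle_measure p a q \<and> angle_measure p a q < angle_measure p a b}"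

text \<open>\<open>interior_angle X S p a b\<close>: the counterclockwise angle from \<open>pa\<close> to \<open>pb\<close> is an interior angle
  of \<open>S\<close> at \<open>p\<close>. Since \<open>s1\<close> and \<open>s2\<close> are interchangeable, always rotating counterclockwise (from
  whichever side) covers both senses of rotation.\<close>

definition interior_angle :: "point set \<Rightarrow> point list \<Rightarrow> point \<Rightarrow> point \<Rightarrow> point \<Rightarrow> bool" where
  "interior_angle X S p a b \<longleftrightarrow>
     (\<exists>s1 \<in> max_segments S. \<exists>s2 \<in> max_segments S. s1 \<inter> s2 = {p} \<and> a \<in> s1 - {p} \<and> b \<in> s2 - {p}
        \<and> (if \<exists>q \<in> X - (s1 \<union> s2). c2_adj q p
           then \<exists>q \<in> X - (s1 \<union> s2). c2_adj q p \<and> q \<in> angle_interior p a b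
           else angle_measure p a b = pi / 4))"

text \<open>The variable \<open>s\<close> ranges over the slanted digital segments contained in the set
  \<open>Bd X\<close>; they need not be edges of \<open>S\<close>.\<close>

definition thick_wrt :: "point set \<Rightarrow> point list \<Rightarrow> bool" where
  "thick_wrt X S \<longleftrightarrow> bounding_curve S X
     \<and> (\<forall>s p. s \<subseteq> Bd X \<and> digital_segment s \<and> card s \<ge> 2 \<and> slanted s \<and> p \<in> s - segment_endpoints s \<longrightarrow>
          (\<exists>c\<in>X. emb c \<notin> affine hull (emb ` s) \<and> c2_adj c p \<and> \<not> c1_adj c p))
     \<and> (\<forall>p a b. interior_angle X S p a b \<and> angle_measure p a b = 3 * pi / 4 \<longrightarrow>
          (\<exists>d \<in> X \<inter> angle_interior p a b. \<exists>d' \<in> X \<inter> angle_interior p a b.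
             c2_adj d p \<and> \<not> c1_adj d p \<and> c1_adj d' p))"

end

theory Submission
  imports Defs
begin

text \<open>
  Why \<open>B\<close> is freezing. A continuous map moves adjacent points to points that are equal or
  adjacent, so it is 1-Lipschitz in each coordinate. A slanted segment is the only shortest
  \<open>c\<^sub>2\<close>-path between its two endpoints, hence it is fixed pointwise as soon as these are
  (\<open>slanted_fixed\<close>). Every point of \<open>S\<close> lies on a horizontal, vertical or slanted maximal
  segment (\<open>curve_point_in_edge\<close>), so \<open>S\<close> is fixed, and with it \<open>Bd X\<close>. Finally, walking from any
  point in one of the four axis directions to the boundary shows that it cannot be moved against
  that direction (\<open>fixed_boundary_imp_identity\<close>).

  Why no point of \<open>B\<close> can be spared. It is enough that each \<open>p \<in> B\<close> can be folded onto another
  point \<open>z\<close> of \<open>X\<close>, that is, all neighbours of \<open>p\<close> in \<open>X\<close> are equal or adjacent to \<open>z\<close>: then moving \<open>p\<close>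
  alone is continuous (\<open>foldable_not_freezing\<close>). Convexity leaves two kinds of points in \<open>B\<close>. An
  endpoint of a maximal segment is a vertex of the hull of \<open>X\<close>; other points of \<open>B\<close> lie in the middle of
  a horizontal or vertical edge, and the line of such an edge supports the hull
  (\<open>axis_edge_supports\<close>).

  In both cases all neighbours of \<open>p\<close> lie, up to a symmetry of the lattice, on or above the
  horizontal line through \<open>p\<close>, and the natural target is the point directly above \<open>p\<close>. The only
  danger is that this point is missing from \<open>X\<close>. The curve \<open>S\<close> may cross itself between lattice
  points, where two diagonal steps meet, so it is not a Jordan curve, and a local picture of \<open>S\<close>
  at \<open>p\<close> does not settle which side is inside. A parity argument does: if \<open>a\<close> and \<open>b\<close> are points of \<open>S\<close> to the right and
  to the left of \<open>p\<close>, adjacent to \<open>p\<close>, then an arc of \<open>S\<close> from \<open>a\<close> to \<open>b\<close> avoiding \<open>p\<close>, closed up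
  through \<open>p\<close>, is crossed exactly once by the downward ray from the point above \<open>p\<close>, provided no
  point of \<open>S\<close> lies directly below \<open>p\<close>. So that point is not in the unbounded component
  (\<open>framed_point_above\<close>). Conversely, if the point above a vertex is missing, there is no such
  pair, and the neighbours of the vertex span so little room that any of them is a target
  (\<open>foldable_octant\<close>).
\<close>

section \<open>Adjacency, connectedness and components\<close>

text \<open>Connectedness by paths as lists is awkward in inductions, so it is replaced by reachability
  through a reflexive transitive closure.\<close>

definition linked :: "(point \<Rightarrow> point \<Rightarrow> bool) \<Rightarrow> point set \<Rightarrow> point \<Rightarrow> point \<Rightarrow> bool" where
  "linked \<kappa> Y = (\<lambda>u v. u \<in> Y \<and> v \<in> Y \<and> \<kappa> u v)\<^sup>*\<^sup>*"

lemma c1_adj_sym: "c1_adj u v \<Longrightarrow> c1_adj v u"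
  by (auto simp: c1_adj_def)

lemma c2_adj_sym: "c2_adj u v \<Longrightarrow> c2_adj v u"
  by (auto simp: c2_adj_def)

lemma BdI: "x \<in> X \<Longrightarrow> y \<notin> X \<Longrightarrow> c1_adj y x \<Longrightarrow> x \<in> Bd X"
  unfolding Bd_def by blast

lemma symp_adj: "symp c1_adj" "symp c2_adj"
  using c1_adj_sym c2_adj_sym by (auto simp: symp_def)

lemma dpath_iff_successively:
  "dpath \<kappa> ps \<longleftrightarrow> ps \<noteq> [] \<and> successively (\<lambda>u v. u = v \<or> \<kappa> u v) ps"
  by (auto simp: dpath_def successively_conv_nth)

lemma linked_sym:
  assumes "symp \<kappa>" and "linked \<kappa> Y x y"
  shows "linked \<kappa> Y y x"
proof -
  have "symp (\<lambda>u v. u \<in> Y \<and> v \<in> Y \<and> \<kappa> u v)"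
    using assms(1) by (auto simp: symp_def)
  from symp_rtranclp[OF this] assms(2) show ?thesis
    unfolding linked_def by (rule sympD)
qed

lemma linked_trans: "linked \<kappa> Y x y \<Longrightarrow> linked \<kappa> Y y z \<Longrightarrow> linked \<kappa> Y x z"
  unfolding linked_def by (rule rtranclp_trans)

lemma linked_step: "linked \<kappa> Y x y \<Longrightarrow> y \<in> Y \<Longrightarrow> z \<in> Y \<Longrightarrow> \<kappa> y z \<Longrightarrow> linked \<kappa> Y x z"
  unfolding linked_def by (rule rtranclp.rtrancl_into_rtrancl) auto

lemma linked_mono: "linked \<kappa> Y x y \<Longrightarrow> Y \<subseteq> Z \<Longrightarrow> linked \<kappa> Z x y"
  unfolding linked_def by (erule rtranclp_mono[THEN predicate2D, rotated]) auto

lemma linked_in: "linked \<kappa> Y x y \<Longrightarrow> x \<in> Y \<Longrightarrow> y \<in> Y"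
  unfolding linked_def by (induction rule: rtranclp_induct) auto

lemma dpath_linked:
  assumes "successively (\<lambda>u v. u = v \<or> \<kappa> u v) ps" "ps \<noteq> []" "set ps \<subseteq> Y"
  shows "linked \<kappa> Y (hd ps) (last ps)"
  using assms
proof (induction ps rule: induct_list012)
  case (3 x y zs)
  have "linked \<kappa> Y y (last (y # zs))"
    using 3 by auto
  moreover have "linked \<kappa> Y x y"
    using 3(3,5) by (auto simp: linked_def)
  ultimately show ?case
    using linked_trans by fastforce
qed (auto simp: linked_def)

lemma linked_dpath:
  assumes "linked \<kappa> Y x y" "x \<in> Y"
  shows "\<exists>ps. dpath \<kappa> ps \<and> set ps \<subseteq> Y \<and> hd ps = x \<and> last ps = y"
  using assms unfolding linked_def
proof (induction rule: rtranclp_induct)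
  case base
  then show ?case
    by (intro exI[of _ "[x]"]) (auto simp: dpath_def)
next
  case (step y z)
  then obtain ps where "dpath \<kappa> ps" "set ps \<subseteq> Y" "hd ps = x" "last ps = y"
    by blast
  with step show ?case
    by (intro exI[of _ "ps @ [z]"]) (auto simp: dpath_iff_successively successively_append_iff)
qed

lemma linked_iff_dpath:
  assumes "x \<in> Y"
  shows "linked \<kappa> Y x y \<longleftrightarrow> (\<exists>ps. dpath \<kappa> ps \<and> set ps \<subseteq> Y \<and> hd ps = x \<and> last ps = y)"
proof
  assume "linked \<kappa> Y x y"
  then show "\<exists>ps. dpath \<kappa> ps \<and> set ps \<subseteq> Y \<and> hd ps = x \<and> last ps = y"
    using assms by (rule linked_dpath)
next
  assume "\<exists>ps. dpath \<kappa> ps \<and> set ps \<subseteq> Y \<and> hd ps = x \<and> last ps = y"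
  then obtain ps where "dpath \<kappa> ps" "set ps \<subseteq> Y" "hd ps = x" "last ps = y" by blast
  then show "linked \<kappa> Y x y"
    using dpath_linked[of \<kappa> ps Y] by (simp add: dpath_iff_successively)
qed

lemma dconnected_iff_linked: "dconnected \<kappa> Y \<longleftrightarrow> (\<forall>x\<in>Y. \<forall>y\<in>Y. linked \<kappa> Y x y)"
  by (simp add: dconnected_def linked_iff_dpath)

lemma dconnected_image:
  assumes "dconnected \<kappa> Y"
    and step: "\<And>u v. u \<in> Y \<Longrightarrow> v \<in> Y \<Longrightarrow> \<kappa> u v \<Longrightarrow> f u = f v \<or> \<kappa> (f u) (f v)"
  shows "dconnected \<kappa> (f ` Y)"
proof -
  have "linked \<kappa> (f ` Y) (f x) (f y)" if "linked \<kappa> Y x y" for x y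
    using that unfolding linked_def
  proof (induction rule: rtranclp_induct)
    case (step y z)
    then show ?case
      using assms(2)[of y z] by (auto intro: rtranclp.rtrancl_into_rtrancl)
  qed auto
  then show ?thesis
    using assms(1) by (auto simp: dconnected_iff_linked)
qed

lemma dconnected_chain:
  assumes sym: "symp \<kappa>"
    and step: "\<And>j. m \<le> j \<Longrightarrow> Suc j \<le> k \<Longrightarrow> \<kappa> (g j) (g (Suc j))"
  shows "dconnected \<kappa> (g ` {m..k})"
proof -
  have *: "linked \<kappa> (g ` {m..k}) (g m) (g j)" if "m \<le> j" "j \<le> k" for j
    using that
  proof (induction j rule: dec_induct)
    case (step n)
    show ?case
      using assms(2)[of n] step by (intro linked_step[OF step(3)]) simp_all
  qed (simp add: linked_def)
  show ?thesis
    unfolding dconnected_iff_linked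
  proof (intro ballI)
    fix y z assume "y \<in> g ` {m..k}" "z \<in> g ` {m..k}"
    then obtain i j where "y = g i" "z = g j" "m \<le> i" "i \<le> k" "m \<le> j" "j \<le> k"
      by auto
    then show "linked \<kappa> (g ` {m..k}) y z"
      using linked_trans[OF linked_sym[OF sym *[of i]] *[of j]] by simp
  qed
qed

lemma dconnected_pair: "\<kappa> u v \<Longrightarrow> \<kappa> v u \<Longrightarrow> dconnected \<kappa> {u, v}"
  by (auto simp: dconnected_iff_linked linked_def)

lemma pair_connected_adj:
  assumes "dconnected \<kappa> {u, v}" "u \<noteq> v"
  shows "\<kappa> u v"
proof -
  have "linked \<kappa> {u, v} u v"
    using assms(1) by (simp add: dconnected_iff_linked)
  then have "v = u \<or> \<kappa> u v"
    unfolding linked_def by (induction rule: rtranclp_induct) auto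
  then show ?thesis
    using assms(2) by auto
qed

text \<open>
  A discrete intermediate value theorem: an integer function that changes by at most 1 along each
  step of a path cannot jump over \<open>t\<close>.
\<close>

lemma connected_hits_value:
  fixes g :: "point \<Rightarrow> int"
  assumes conn: "dconnected c2_adj Y"
    and lip: "\<And>u v. c2_adj u v \<Longrightarrow> \<bar>g u - g v\<bar> \<le> 1"
    and "u \<in> Y" "w \<in> Y" "g u \<le> t" "t \<le> g w"
  shows "\<exists>q\<in>Y. g q = t"
proof (rule ccontr)
  assume none: "\<not> (\<exists>q\<in>Y. g q = t)"
  have "linked c2_adj Y u w"
    using conn assms(3,4) by (simp add: dconnected_iff_linked)
  then have "g w < t"
    unfolding linked_def
  proof (induction rule: rtranclp_induct)
    case base
    then show ?case using none assms(3,5) by fastforce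
  next
    case (step y z)
    then show ?case using none lip[of y z] by fastforce
  qed
  with assms(6) show False by simp
qed

lemma dconnected_linked_class:
  assumes sym: "symp \<kappa>"
  shows "dconnected \<kappa> {y. linked \<kappa> Y x y}"
proof -
  have into: "linked \<kappa> {y. linked \<kappa> Y x y} x y" if "linked \<kappa> Y x y" for y
    using that unfolding linked_def
  proof (induction rule: rtranclp_induct)
    case (step y z)
    then show ?case
      by (auto intro!: rtranclp.rtrancl_into_rtrancl[OF step(3)]
          intro: rtranclp.rtrancl_into_rtrancl)
  qed auto
  show ?thesis
    unfolding dconnected_iff_linked
  proof (intro ballI)
    fix y z assume "y \<in> {y. linked \<kappa> Y x y}" "z \<in> {y. linked \<kappa> Y x y}"
    then show "linked \<kappa> {y. linked \<kappa> Y x y} y z"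
      using linked_trans[OF linked_sym[OF sym into[of y]] into[of z]] by simp
  qed
qed

lemma finite_coordinate_extrema:
  fixes g :: "point \<Rightarrow> int"
  assumes "finite Y" "Y \<noteq> {}"
  obtains u v where "u \<in> Y" "\<And>q. q \<in> Y \<Longrightarrow> g u \<le> g q" "v \<in> Y" "\<And>q. q \<in> Y \<Longrightarrow> g q \<le> g v"
proof -
  obtain u where "u \<in> Y" "\<And>q. q \<in> Y \<Longrightarrow> g u \<le> g q"
    using ex_is_arg_min_if_finite[OF assms, of g] by (auto simp: is_arg_min_linorder)
  moreover obtain v where "v \<in> Y" "\<And>q. q \<in> Y \<Longrightarrow> g q \<le> g v"
    using ex_is_arg_min_if_finite[OF assms, of "\<lambda>q. - g q"] by (auto simp: is_arg_min_linorder)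
  ultimately show ?thesis using that by blast
qed

lemma component_eq_linked:
  assumes sym: "symp \<kappa>"
    and "C \<in> dcomponents \<kappa> Y" "x \<in> C"
  shows "C = {y. linked \<kappa> Y x y}"
proof
  have C: "C \<subseteq> Y" "dconnected \<kappa> C"
    "\<And>C'. C \<subseteq> C' \<Longrightarrow> C' \<subseteq> Y \<Longrightarrow> dconnected \<kappa> C' \<Longrightarrow> C' = C"
    using assms(2) by (auto simp: dcomponents_def)
  show sub: "C \<subseteq> {y. linked \<kappa> Y x y}"
    using C(2) assms(3) linked_mono[OF _ C(1)] unfolding dconnected_iff_linked by blast
  have "dconnected \<kappa> {y. linked \<kappa> Y x y}"
    by (rule dconnected_linked_class[OF sym])
  moreover have "{y. linked \<kappa> Y x y} \<subseteq> Y"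
    using C(1) assms(3) linked_in by blast
  ultimately show "{y. linked \<kappa> Y x y} \<subseteq> C"
    using C(3)[OF sub] by simp
qed

lemma linked_class_is_component:
  assumes sym: "symp \<kappa>" and "x \<in> Y"
  shows "{y. linked \<kappa> Y x y} \<in> dcomponents \<kappa> Y"
proof -
  let ?C = "{y. linked \<kappa> Y x y}"
  have "dconnected \<kappa> ?C"
    by (rule dconnected_linked_class[OF sym])
  moreover have "?C \<subseteq> Y"
    using assms(2) linked_in by blast
  moreover have "C' = ?C" if "?C \<subseteq> C'" "C' \<subseteq> Y" "dconnected \<kappa> C'" for C'
  proof -
    have "x \<in> C'"
      using that(1) by (auto simp: linked_def)
    then have "C' \<subseteq> ?C"
      using that(3) linked_mono[OF _ that(2)] unfolding dconnected_iff_linked by blast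
    then show ?thesis using that(1) by auto
  qed
  ultimately show ?thesis
    by (auto simp: dcomponents_def)
qed

section \<open>Crossing parity\<close>

text \<open>The step from \<open>u\<close> to \<open>v\<close> crosses the ray that starts slightly to the right of \<open>q\<close> and runs straight
  down; the shift to the right keeps the ray off the lattice. Whether a crossing is below \<open>q\<close> is
  read off at the endpoint in the column of \<open>q\<close>, which is unambiguous if the walk avoids \<open>q\<close>.\<close>

definition crosses_below :: "point \<Rightarrow> point \<Rightarrow> point \<Rightarrow> bool" where
  "crosses_below q u v \<longleftrightarrow>
     (fst u = fst q \<and> fst v = fst q + 1 \<and> snd u < snd q) \<or>
     (fst v = fst q \<and> fst u = fst q + 1 \<and> snd v < snd q)"

fun odd_crossings :: "point \<Rightarrow> point list \<Rightarrow> bool" where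
  "odd_crossings q (u # v # ws) \<longleftrightarrow> crosses_below q u v \<noteq> odd_crossings q (v # ws)"
| "odd_crossings q _ \<longleftrightarrow> False"

lemma odd_crossings_snoc:
  "ps \<noteq> [] \<Longrightarrow> odd_crossings q (ps @ [v]) \<longleftrightarrow> odd_crossings q ps \<noteq> crosses_below q (last ps) v"
  by (induction ps rule: induct_list012) auto

lemma odd_crossings_up:
  assumes "(x, y) \<notin> set ws"
  shows "odd_crossings (x, y + 1) ws \<longleftrightarrow> odd_crossings (x, y) ws"
  using assms
proof (induction ws rule: induct_list012)
  case (3 u v ws)
  have "crosses_below (x, y + 1) u v \<longleftrightarrow> crosses_below (x, y) u v"
    using 3(3) by (cases u; cases v) (auto simp: crosses_below_def)
  then show ?case using 3 by simp
qed auto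

text \<open>A handshake argument for the part of column \<open>x + 1\<close> below height \<open>y\<close>. A walk avoiding
  \<open>(x, y)\<close> and \<open>(x + 1, y)\<close> can enter or leave it only sideways, across one of the rays below these two
  points, so the two crossing counts together have the parity of the number of entries and exits.\<close>

lemma odd_crossings_right:
  assumes "successively (\<lambda>u v. u = v \<or> c2_adj u v) ws" "ws \<noteq> []"
    and "(x, y) \<notin> set ws" "(x + 1, y) \<notin> set ws"
  shows "(odd_crossings (x, y) ws \<noteq> odd_crossings (x + 1, y) ws) \<longleftrightarrow>
    ((fst (hd ws) = x + 1 \<and> snd (hd ws) < y) \<noteq> (fst (last ws) = x + 1 \<and> snd (last ws) < y))"
  using assms
proof (induction ws rule: induct_list012)
  case (3 u v ws)
  obtain i j k l where uv: "u = (i, j)" "v = (k, l)" by (metis surj_pair)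
  have near: "\<bar>i - k\<bar> \<le> 1" "\<bar>j - l\<bar> \<le> 1"
    using 3(3) uv by (auto simp: c2_adj_def)
  have avoid: "i = x \<Longrightarrow> j \<noteq> y" "k = x \<Longrightarrow> l \<noteq> y" "i = x + 1 \<Longrightarrow> j \<noteq> y" "k = x + 1 \<Longrightarrow> l \<noteq> y"
    using 3(5,6) uv by auto
  have "(crosses_below (x, y) u v \<noteq> crosses_below (x + 1, y) u v) \<longleftrightarrow>
      ((fst u = x + 1 \<and> snd u < y) \<noteq> (fst v = x + 1 \<and> snd v < y))"
    using near avoid unfolding crosses_below_def uv fst_conv snd_conv
    by (cases "i = x"; cases "i = x + 1"; cases "k = x"; cases "k = x + 1") auto
  moreover have "(odd_crossings (x, y) (v # ws) \<noteq> odd_crossings (x + 1, y) (v # ws)) \<longleftrightarrow>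
      ((fst v = x + 1 \<and> snd v < y) \<noteq> (fst (last (v # ws)) = x + 1 \<and> snd (last (v # ws)) < y))"
    using 3 by simp
  moreover have "last (u # v # ws) = last (v # ws)" by simp
  ultimately show ?case unfolding odd_crossings.simps list.sel by metis
qed auto

lemma odd_crossings_low:
  assumes "\<And>u. u \<in> set ws \<Longrightarrow> snd q \<le> snd u"
  shows "\<not> odd_crossings q ws"
  using assms
proof (induction ws rule: induct_list012)
  case (3 u v ws)
  then show ?case by (auto simp: crosses_below_def not_less)
qed auto

text \<open>One half of a Jordan theorem: diagonal steps of the walk never block a \<open>c\<^sub>1\<close>-path, so
  the parity is constant on \<open>c\<^sub>1\<close>-connected sets disjoint from a closed \<open>c\<^sub>2\<close>-walk.\<close>

lemma odd_crossings_invariant: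
  assumes walk: "successively (\<lambda>u v. u = v \<or> c2_adj u v) ws" "ws \<noteq> []" "hd ws = last ws"
    and disj: "set ws \<inter> Z = {}"
    and link: "linked c1_adj Z q q'"
  shows "odd_crossings q ws \<longleftrightarrow> odd_crossings q' ws"
  using link unfolding linked_def
proof (induction rule: rtranclp_induct)
  case (step r s)
  obtain a b where r: "r = (a, b)" by force
  have ns: "r \<notin> set ws" "s \<notin> set ws"
    using step(2) disj by auto
  have "s = (a + 1, b) \<or> s = (a - 1, b) \<or> s = (a, b + 1) \<or> s = (a, b - 1)"
    using step(2) r by (cases s) (auto simp: c1_adj_def)
  then have "odd_crossings r ws \<longleftrightarrow> odd_crossings s ws"
    using ns r odd_crossings_up[of a b ws] odd_crossings_up[of a "b - 1" ws]
      odd_crossings_right[OF walk(1,2), of a b] odd_crossings_right[OF walk(1,2), of "a - 1" b]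
      walk(3)
    by auto
  then show ?case using step by simp
qed auto

section \<open>Framed sets\<close>

text \<open>The properties of a disk \<open>X\<close> and its bounding curve \<open>S\<close> on which the folding argument relies. They
  mention only point sets, which makes them easy to transport along symmetries of the lattice.
  Connectedness of \<open>S - {p}\<close> is what remains of the cyclic order of the curve.\<close>

definition framed :: "point set \<Rightarrow> point set \<Rightarrow> bool" where
  "framed X S \<longleftrightarrow> finite X \<and> dconnected c1_adj (- X) \<and> Bd X \<subseteq> S \<and> S \<subseteq> X
     \<and> (\<forall>p\<in>S. dconnected c2_adj (S - {p})) \<and> (\<forall>p\<in>S. \<exists>q\<in>S. c2_adj q p)"

text \<open>Join \<open>a\<close> to \<open>b\<close> inside \<open>S - {p}\<close> and close the walk through \<open>p\<close>. Of all its steps only the one from \<open>p\<close> to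
  \<open>a\<close> crosses the ray below the point above \<open>p\<close>, because a crossing step has an endpoint below that point in the column of \<open>p\<close>, where
  \<open>p\<close> is the only point of \<open>S\<close>. The parity is therefore
  odd there, but it is even far below \<open>X\<close>, and it is constant on the connected complement of \<open>X\<close>.\<close>

lemma framed_point_above:
  assumes fr: "framed X S" and S: "p \<in> S" "a \<in> S" "b \<in> S"
    and a: "c2_adj a p" "fst a = fst p + 1" and b: "c2_adj b p" "fst b = fst p - 1"
    and below: "\<And>y. (fst p, y) \<in> S \<Longrightarrow> snd p \<le> y"
  shows "(fst p, snd p + 1) \<in> X"
proof (rule ccontr)
  let ?N = "(fst p, snd p + 1)"
  assume N: "?N \<notin> X"
  have "a \<in> S - {p}" "b \<in> S - {p}"
    using S a b by (auto simp: c2_adj_def)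
  then obtain ps where ps: "dpath c2_adj ps" "set ps \<subseteq> S - {p}" "hd ps = a" "last ps = b"
    using fr S(1) unfolding framed_def dconnected_def by blast
  let ?W = "p # ps @ [p]"
  have ne: "ps \<noteq> []" and suc: "successively (\<lambda>u v. u = v \<or> c2_adj u v) ps"
    using ps(1) by (auto simp: dpath_iff_successively)
  have walk: "successively (\<lambda>u v. u = v \<or> c2_adj u v) ?W"
    using ne suc ps a b c2_adj_sym
    by (auto simp: successively_append_iff successively_Cons)
  have no: "\<not> crosses_below ?N u v" if "u \<in> S - {p}" "v \<in> S - {p}" for u v
    using that below[of "snd u"] below[of "snd v"]
    by (cases u; cases v; cases p) (auto simp: crosses_below_def)
  have "\<not> odd_crossings ?N qs" if "set qs \<subseteq> S - {p}" for qs
    using that by (induction qs rule: induct_list012) (auto simp: no)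
  then have "\<not> odd_crossings ?N ps"
    using ps(2) by blast
  moreover have "crosses_below ?N p a" "\<not> crosses_below ?N b p"
    using a b by (auto simp: crosses_below_def)
  moreover have "odd_crossings ?N ?W \<longleftrightarrow> crosses_below ?N p a \<noteq> odd_crossings ?N (ps @ [p])"
    using ne ps(3) by (cases ps) auto
  ultimately have odd: "odd_crossings ?N ?W"
    using odd_crossings_snoc[OF ne, of ?N p] ps(4) by simp
  have WX: "set ?W \<subseteq> X"
    using ps(2) S(1) fr by (auto simp: framed_def)
  have fin: "finite X" using fr by (simp add: framed_def)
  define m where "m = Min (snd ` X)"
  have m: "m \<le> snd u" if "u \<in> X" for u
    unfolding m_def using that fin by simp
  have "(fst p, m - 1) \<notin> X"
    using m by fastforce
  then have "linked c1_adj (- X) ?N (fst p, m - 1)"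
    using fr N by (simp add: framed_def dconnected_iff_linked)
  then have "odd_crossings (fst p, m - 1) ?W"
    using odd_crossings_invariant[OF walk, of "- X" ?N "(fst p, m - 1)"] WX odd by auto
  moreover have "\<not> odd_crossings (fst p, m - 1) ?W"
    using m WX by (intro odd_crossings_low) fastforce
  ultimately show False by contradiction
qed

definition lattice_symmetry :: "(point \<Rightarrow> point) \<Rightarrow> bool" where
  "lattice_symmetry T \<longleftrightarrow> bij T \<and> (\<forall>u v. c1_adj (T u) (T v) \<longleftrightarrow> c1_adj u v)
     \<and> (\<forall>u v. c2_adj (T u) (T v) \<longleftrightarrow> c2_adj u v)"

lemma lattice_symmetries:
  "lattice_symmetry (\<lambda>p. (snd p, fst p))"
  "lattice_symmetry (\<lambda>p. (- fst p, snd p))"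
  "lattice_symmetry (\<lambda>p. (fst p, - snd p))"
proof -
  have b: "bij T" if "T \<circ> T = id" for T :: "point \<Rightarrow> point"
    using that o_bij by blast
  show "lattice_symmetry (\<lambda>p. (snd p, fst p))"
    "lattice_symmetry (\<lambda>p. (- fst p, snd p))"
    "lattice_symmetry (\<lambda>p. (fst p, - snd p))"
    by (auto simp: lattice_symmetry_def c1_adj_def c2_adj_def fun_eq_iff prod_eq_iff intro!: b)
qed

lemma framed_image:
  assumes "framed X S" "lattice_symmetry T"
  shows "framed (T ` X) (T ` S)"
proof -
  have bij: "bij T" and inj: "inj T" and c1: "\<And>u v. c1_adj (T u) (T v) \<longleftrightarrow> c1_adj u v"
    and c2: "\<And>u v. c2_adj (T u) (T v) \<longleftrightarrow> c2_adj u v"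
    using assms(2) by (auto simp: lattice_symmetry_def bij_def)
  have compl: "- (T ` X) = T ` (- X)"
    using bij by (simp add: bij_image_Compl_eq)
  have "dconnected c1_adj (- (T ` X))"
    unfolding compl using assms(1) by (intro dconnected_image) (auto simp: framed_def c1)
  moreover have "Bd (T ` X) \<subseteq> T ` S"
  proof
    fix x assume "x \<in> Bd (T ` X)"
    then obtain x' y where "x' \<in> X" "x = T x'" "y \<in> - (T ` X)" "c1_adj y x"
      by (auto simp: Bd_def)
    moreover then obtain y' where "y' \<notin> X" "y = T y'"
      unfolding compl by auto
    ultimately have "x' \<in> Bd X"
      by (intro BdI[of _ _ y']) (auto simp: c1)
    then show "x \<in> T ` S"
      using assms(1) \<open>x = T x'\<close> by (auto simp: framed_def)
  qed
  moreover have "dconnected c2_adj (T ` S - {T p})" if "p \<in> S" for p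
  proof -
    have "T ` S - {T p} = T ` (S - {p})"
      using inj by (simp add: image_set_diff)
    then show ?thesis
      using that assms(1) by (auto intro!: dconnected_image simp: framed_def c2)
  qed
  ultimately show ?thesis
    using assms(1) unfolding framed_def by (auto simp: c2)
qed

section \<open>Folding away a point\<close>

definition foldable :: "point set \<Rightarrow> point \<Rightarrow> bool" where
  "foldable X p \<longleftrightarrow> (\<exists>z\<in>X. z \<noteq> p \<and> (\<forall>q\<in>X. c2_adj q p \<longrightarrow> q = z \<or> c2_adj q z))"

lemma foldable_image:
  assumes "foldable (T ` X) (T p)" "lattice_symmetry T"
  shows "foldable X p"
proof -
  have inj: "inj T" and c2: "\<And>u v. c2_adj (T u) (T v) \<longleftrightarrow> c2_adj u v"
    using assms(2) by (auto simp: lattice_symmetry_def bij_def)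
  show ?thesis
    using assms(1) inj unfolding foldable_def by (auto simp: c2 inj_eq)
qed

text \<open>The map that sends \<open>p\<close> to \<open>z\<close> and fixes all other points is continuous and not the identity.\<close>

lemma foldable_not_freezing:
  assumes "foldable X p" "p \<in> X" "p \<notin> A"
  shows "\<not> freezing_set X c2_adj A"
proof
  assume fs: "freezing_set X c2_adj A"
  obtain z where z: "z \<in> X" "z \<noteq> p" "\<And>q. q \<in> X \<Longrightarrow> c2_adj q p \<Longrightarrow> q = z \<or> c2_adj q z"
    using assms(1) by (auto simp: foldable_def)
  let ?f = "id(p := z)"
  have "?f \<in> dcontinuous_maps X c2_adj"
    unfolding dcontinuous_maps_def
  proof (intro CollectI conjI allI impI)
    show "?f ` X \<subseteq> X" using z(1) by auto
    fix A assume A: "A \<subseteq> X \<and> dconnected c2_adj A"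
    show "dconnected c2_adj (?f ` A)"
    proof (rule dconnected_image)
      fix u v assume uv: "u \<in> A" "v \<in> A" "c2_adj u v"
      then have "u \<noteq> v" by (simp add: c2_adj_def)
      with uv A z(3)[of u] z(3)[of v] c2_adj_sym[of u v] c2_adj_sym[of v z]
      show "?f u = ?f v \<or> c2_adj (?f u) (?f v)"
        by auto
    qed (use A in blast)
  qed
  moreover have "A \<subseteq> Fix_on X ?f"
    using assms(3) fs by (auto simp: Fix_on_def freezing_set_def)
  ultimately have "?f p = p"
    using fs assms(2) unfolding freezing_set_def by blast
  with z(2) show False by simp
qed

text \<open>A supporting line at \<open>p\<close> whose normal \<open>(a, b)\<close> points up, or up and to the right by at most 45 degrees,
  leaves room for neighbours of \<open>p\<close> only in the directions east, north-east, north and north-west.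
  The northern point is adjacent to all the others, so it is a target if it is in \<open>X\<close>. If it is
  not, then any of its \<open>c\<^sub>1\<close>-neighbours in \<open>X\<close> is a boundary point and so lies on \<open>S\<close>;
  by \<open>framed_point_above\<close> a north-western neighbour then excludes eastern ones, and any
  neighbour of \<open>p\<close> is a target.\<close>

lemma foldable_octant:
  fixes a b :: real
  assumes fr: "framed X S" and "p \<in> X" and ab: "0 \<le> a" "a \<le> b"
    and pos: "\<And>q. q \<in> X \<Longrightarrow> q \<noteq> p \<Longrightarrow> 0 < a * (fst q - fst p) + b * (snd q - snd p)"
  shows "foldable X p"
proof -
  obtain x y where p: "p = (x, y)" by force
  have fr': "Bd X \<subseteq> S" "S \<subseteq> X" using fr by (auto simp: framed_def)
  have edge: "u \<in> S" if "u \<in> X" "v \<notin> X" "c1_adj v u" for u v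
    using that fr' BdI by blast
  have below: "(x, t) \<notin> X" if "t < y" for t
  proof
    assume "(x, t) \<in> X"
    then have "0 < b * (t - y)" using pos[of "(x, t)"] that p by auto
    moreover have "b * (t - y) \<le> 0"
      using ab that by (intro mult_nonneg_nonpos) auto
    ultimately show False by simp
  qed
  have dirs: "q \<in> {(x + 1, y), (x + 1, y + 1), (x, y + 1), (x - 1, y + 1)}"
    if "q \<in> X" "c2_adj q p" for q
  proof -
    obtain i j where q: "q = (x + i, y + j)"
      by (metis add_diff_cancel_left' diff_add_cancel surj_pair add.commute)
    have ij: "i = -1 \<or> i = 0 \<or> i = 1" "j = -1 \<or> j = 0 \<or> j = 1" "\<not> (i = 0 \<and> j = 0)"
      using that(2) unfolding q p c2_adj_def by auto
    have "0 < a * i + b * j"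
      using pos[OF that(1)] ij(3) unfolding q p by auto
    with ij ab show ?thesis unfolding q by auto
  qed
  have pS: "p \<in> S"
    using edge[of p "(x, y - 1)"] below[of "y - 1"] assms(2) p by (simp add: c1_adj_def)
  then obtain q0 where q0: "q0 \<in> X" "c2_adj q0 p"
    using fr fr'(2) unfolding framed_def by blast
  have above: "(x, y + 1) \<in> X" if "u \<in> S" "v \<in> S" "c2_adj u p" "c2_adj v p" "fst u = x + 1" "fst v = x - 1" for u v
  proof -
    have "(fst p, snd p + 1) \<in> X"
    proof (rule framed_point_above[OF fr pS that(1,2,3) _ that(4)])
      show "snd p \<le> t" if "(fst p, t) \<in> S" for t
        using that below[of t] fr' p by force
    qed (use that p in auto)
    then show ?thesis using p by simp
  qed
  show ?thesis
  proof (cases "(x, y + 1) \<in> X")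
    case True
    have "q = (x, y + 1) \<or> c2_adj q (x, y + 1)" if "q \<in> X" "c2_adj q p" for q
      using dirs[OF that] by (auto simp: c2_adj_def)
    then show ?thesis
      unfolding foldable_def using True p by (intro bexI[of _ "(x, y + 1)"]) auto
  next
    case N: False
    have nw: "(x - 1, y + 1) \<in> X \<Longrightarrow> (x - 1, y + 1) \<in> S"
      and ne: "(x + 1, y + 1) \<in> X \<Longrightarrow> (x + 1, y + 1) \<in> S"
      using edge[OF _ N] by (auto simp: c1_adj_def)
    (* The eastern neighbour is not next to the missing northern point, but it is next to the
       north-eastern one: if that is missing too, the eastern neighbour lies on S, and otherwise
       the north-eastern one lies on S and serves instead. *)
    have e: "(x + 1, y + 1) \<notin> X \<Longrightarrow> (x + 1, y) \<in> X \<Longrightarrow> (x + 1, y) \<in> S"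
      using edge[of "(x + 1, y)" "(x + 1, y + 1)"] by (auto simp: c1_adj_def)
    have excl: "\<not> ((x - 1, y + 1) \<in> X \<and> ((x + 1, y + 1) \<in> X \<or> (x + 1, y) \<in> X))"
      using above[of "(x + 1, y + 1)" "(x - 1, y + 1)"] above[of "(x + 1, y)" "(x - 1, y + 1)"]
        nw ne e N p by (auto simp: c2_adj_def)
    have q0p: "q0 \<noteq> p" using q0(2) by (auto simp: c2_adj_def)
    have "q = q0 \<or> c2_adj q q0" if "q \<in> X" "c2_adj q p" for q
      using dirs[OF that] dirs[OF q0] that(1) q0(1) excl N by (auto simp: c2_adj_def)
    then show ?thesis
      unfolding foldable_def using q0(1) q0p by blast
  qed
qed

lemma foldable_quadrant:
  fixes a b :: real
  assumes fr: "framed X S" and "p \<in> X" and ab: "0 \<le> a" "0 \<le> b"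
    and pos: "\<And>q. q \<in> X \<Longrightarrow> q \<noteq> p \<Longrightarrow> 0 < a * (fst q - fst p) + b * (snd q - snd p)"
  shows "foldable X p"
proof (cases "a \<le> b")
  case True
  then show ?thesis using foldable_octant[OF fr assms(2) ab(1) True pos] by blast
next
  case False
  let ?T = "\<lambda>p. (snd p, fst p) :: point"
  have "foldable (?T ` X) (?T p)"
  proof (rule foldable_octant[OF framed_image[OF fr lattice_symmetries(1)], where a = b and b = a])
    fix q assume "q \<in> ?T ` X" "q \<noteq> ?T p"
    then obtain r where "r \<in> X" "r \<noteq> p" "q = ?T r" by auto
    then show "0 < b * (fst q - fst (?T p)) + a * (snd q - snd (?T p))"
      using pos[of r] by (simp add: algebra_simps)
  qed (use False ab assms(2) in auto)
  then show ?thesis by (rule foldable_image[OF _ lattice_symmetries(1)])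
qed

lemma foldable_upper_halfplane:
  fixes a b :: real
  assumes fr: "framed X S" and "p \<in> X" and ab: "0 \<le> b"
    and pos: "\<And>q. q \<in> X \<Longrightarrow> q \<noteq> p \<Longrightarrow> 0 < a * (fst q - fst p) + b * (snd q - snd p)"
  shows "foldable X p"
proof (cases "0 \<le> a")
  case True
  then show ?thesis using foldable_quadrant[OF fr assms(2) True ab pos] by blast
next
  case False
  let ?T = "\<lambda>p. (- fst p, snd p) :: point"
  have "foldable (?T ` X) (?T p)"
  proof (rule foldable_quadrant[OF framed_image[OF fr lattice_symmetries(2)], where a = "-a" and b = b])
    fix q assume "q \<in> ?T ` X" "q \<noteq> ?T p"
    then obtain r where "r \<in> X" "r \<noteq> p" "q = ?T r" by auto
    then show "0 < - a * (fst q - fst (?T p)) + b * (snd q - snd (?T p))"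
      using pos[of r] by (simp add: algebra_simps)
  qed (use False ab assms(2) in auto)
  then show ?thesis by (rule foldable_image[OF _ lattice_symmetries(2)])
qed

lemma foldable_strict_support:
  fixes a b :: real
  assumes fr: "framed X S" and "p \<in> X"
    and pos: "\<And>q. q \<in> X \<Longrightarrow> q \<noteq> p \<Longrightarrow> 0 < a * (fst q - fst p) + b * (snd q - snd p)"
  shows "foldable X p"
proof (cases "0 \<le> b")
  case True
  then show ?thesis using foldable_upper_halfplane[OF fr assms(2) True pos] by blast
next
  case False
  let ?T = "\<lambda>p. (fst p, - snd p) :: point"
  have "foldable (?T ` X) (?T p)"
  proof (rule foldable_upper_halfplane[OF framed_image[OF fr lattice_symmetries(3)], where a = a and b = "- b"])
    fix q assume "q \<in> ?T ` X" "q \<noteq> ?T p"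
    then obtain r where "r \<in> X" "r \<noteq> p" "q = ?T r" by auto
    then show "0 < a * (fst q - fst (?T p)) + - b * (snd q - snd (?T p))"
      using pos[of r] by (simp add: algebra_simps)
  qed (use False assms(2) in auto)
  then show ?thesis by (rule foldable_image[OF _ lattice_symmetries(3)])
qed

text \<open>A vertex of the hull is separated from the hull of the remaining points by a line, which gives a
  strictly supporting functional.\<close>

lemma foldable_extreme:
  assumes fr: "framed X S" and "p \<in> X" and ext: "emb p extreme_point_of (convex hull (emb ` X))"
  shows "foldable X p"
proof -
  let ?H = "convex hull (emb ` X)"
  let ?Y = "convex hull (emb ` (X - {p}))"
  have fin: "finite X" using fr by (simp add: framed_def)
  have "convex (?H - {emb p})"
    using ext extreme_point_of_stillconvex[of ?H] by simp
  moreover have "emb ` (X - {p}) \<subseteq> ?H - {emb p}"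
    by (auto simp: emb_def complex_eq_iff prod_eq_iff intro!: hull_inc)
  ultimately have "?Y \<subseteq> ?H - {emb p}"
    by (intro hull_minimal)
  then have "emb p \<notin> ?Y" by auto
  moreover have "closed ?Y"
    using fin by (intro compact_imp_closed finite_imp_compact_convex_hull) auto
  ultimately obtain c d where "c \<bullet> emb p < d" and cd: "\<And>x. x \<in> ?Y \<Longrightarrow> d < c \<bullet> x"
    using separating_hyperplane_closed_point[of ?Y "emb p"] by auto
  have "0 < Re c * (fst q - fst p) + Im c * (snd q - snd p)" if "q \<in> X" "q \<noteq> p" for q
  proof -
    have "emb q \<in> ?Y" using that by (intro hull_inc) auto
    from cd[OF this] \<open>c \<bullet> emb p < d\<close> show ?thesis
      by (simp add: inner_complex_def emb_def algebra_simps)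
  qed
  then show ?thesis
    by (intro foldable_strict_support[OF fr assms(2)]) auto
qed

text \<open>A lowest point of \<open>X\<close> has a missing point below it, so it belongs to \<open>S\<close>: an upper
  half-plane containing \<open>S\<close> contains \<open>X\<close>.\<close>

lemma framed_min_on_frame:
  assumes fr: "framed X S" and low: "\<And>w. w \<in> S \<Longrightarrow> c \<le> snd w" and "q \<in> X"
  shows "c \<le> snd q"
proof -
  have fin: "finite X" using fr by (simp add: framed_def)
  have "X \<noteq> {}" using assms(3) by auto
  then obtain r where r: "r \<in> X" "\<And>w. w \<in> X \<Longrightarrow> snd r \<le> snd w"
    using finite_coordinate_extrema[OF fin, of snd] by metis
  then have "(fst r, snd r - 1) \<notin> X" by fastforce
  then have "r \<in> Bd X"
    using r(1) by (intro BdI[of _ _ "(fst r, snd r - 1)"]) (auto simp: c1_adj_def)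
  then have "r \<in> S" using fr by (auto simp: framed_def)
  then show ?thesis using low r(2)[OF assms(3)] by fastforce
qed

lemma foldable_bottom_edge:
  assumes fr: "framed X S" and S: "p \<in> S" "(fst p + 1, snd p) \<in> S" "(fst p - 1, snd p) \<in> S"
    and low: "\<And>w. w \<in> S \<Longrightarrow> snd p \<le> snd w"
  shows "foldable X p"
proof -
  have N: "(fst p, snd p + 1) \<in> X"
    using low by (intro framed_point_above[OF fr S]) (force simp: c2_adj_def prod_eq_iff)+
  have "q = (fst p, snd p + 1) \<or> c2_adj q (fst p, snd p + 1)" if "q \<in> X" "c2_adj q p" for q
    using that(2) framed_min_on_frame[OF fr low that(1)] by (auto simp: c2_adj_def)
  then show ?thesis
    unfolding foldable_def using N by (intro bexI[of _ "(fst p, snd p + 1)"]) (auto simp: prod_eq_iff)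
qed

lemma foldable_horizontal_edge:
  assumes fr: "framed X S" and S: "p \<in> S" "(fst p + 1, snd p) \<in> S" "(fst p - 1, snd p) \<in> S"
    and side: "(\<forall>w\<in>S. snd p \<le> snd w) \<or> (\<forall>w\<in>S. snd w \<le> snd p)"
  shows "foldable X p"
  using side
proof
  assume "\<forall>w\<in>S. snd p \<le> snd w"
  then show ?thesis by (intro foldable_bottom_edge[OF fr S]) auto
next
  assume up: "\<forall>w\<in>S. snd w \<le> snd p"
  let ?T = "\<lambda>p. (fst p, - snd p) :: point"
  have "foldable (?T ` X) (?T p)"
    using S up by (intro foldable_bottom_edge[OF framed_image[OF fr lattice_symmetries(3)]]) (auto simp: image_iff intro: bexI[OF _ S(2)] bexI[OF _ S(3)])
  then show ?thesis by (rule foldable_image[OF _ lattice_symmetries(3)])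
qed

lemma foldable_vertical_edge:
  assumes fr: "framed X S" and S: "p \<in> S" "(fst p, snd p + 1) \<in> S" "(fst p, snd p - 1) \<in> S"
    and side: "(\<forall>w\<in>S. fst p \<le> fst w) \<or> (\<forall>w\<in>S. fst w \<le> fst p)"
  shows "foldable X p"
proof -
  let ?T = "\<lambda>p. (snd p, fst p) :: point"
  have "foldable (?T ` X) (?T p)"
    using S side by (intro foldable_horizontal_edge[OF framed_image[OF fr lattice_symmetries(1)]]) (auto simp: image_iff intro: bexI[OF _ S(2)] bexI[OF _ S(3)])
  then show ?thesis by (rule foldable_image[OF _ lattice_symmetries(1)])
qed

section \<open>Bounding curves\<close>

text \<open>Cyclic indexing: the last entry of the list repeats the first one, so the period is one less
  than the length.\<close>

definition cyc :: "point list \<Rightarrow> nat \<Rightarrow> point" where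
  "cyc S j = S ! (j mod (length S - 1))"

lemma closed_curve_length: "closed_curve S \<Longrightarrow> 2 \<le> length S - 1"
  by (auto simp: closed_curve_def)

lemma cyc_eq_iff:
  assumes "closed_curve S"
  shows "cyc S i = cyc S j \<longleftrightarrow> i mod (length S - 1) = j mod (length S - 1)"
proof
  define n where "n = length S - 1"
  have n: "2 \<le> n" "length S = n + 1"
    using closed_curve_length[OF assms] by (auto simp: n_def)
  assume eq: "cyc S i = cyc S j"
  have lt: "i mod n < n" "j mod n < n" using n by auto
  have distinct: "S ! a \<noteq> S ! b" if "a < n" "b < n" "a \<noteq> b" for a b
    using assms n that by (simp add: closed_curve_def)
  show "i mod (length S - 1) = j mod (length S - 1)"
    using distinct[OF lt] eq unfolding cyc_def n_def[symmetric] by blast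
qed (simp add: cyc_def)

lemma cyc_adj:
  assumes "closed_curve S"
  shows "c2_adj (cyc S j) (cyc S (Suc j))"
proof -
  define n where "n = length S - 1"
  have n: "2 \<le> n" "length S = n + 1"
    using closed_curve_length[OF assms] by (auto simp: n_def)
  define m where "m = j mod n"
  have m: "m < n" using n by (simp add: m_def)
  have "S ! m = S ! Suc m \<or> c2_adj (S ! m) (S ! Suc m)"
    using assms m n by (auto simp: closed_curve_def dpath_def)
  moreover have "S ! m \<noteq> S ! Suc m"
    using assms m n unfolding closed_curve_def by auto
  moreover have "S ! n = S ! 0"
    using assms n by (simp add: closed_curve_def)
  ultimately show ?thesis
    unfolding cyc_def n_def[symmetric] by (auto simp: mod_Suc m_def)
qed

lemma cyc_in_set:
  assumes "closed_curve S"
  shows "cyc S j \<in> set S"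
proof -
  have "j mod (length S - 1) < length S - 1"
    using closed_curve_length[OF assms] by simp
  then show ?thesis by (simp add: cyc_def)
qed

lemma in_curve_cyc:
  assumes "closed_curve S" "x \<in> set S"
  obtains j where "j < length S - 1" "x = cyc S (i + j)"
proof -
  define n where "n = length S - 1"
  have n: "2 \<le> n" "length S = n + 1"
    using closed_curve_length[OF assms(1)] by (auto simp: n_def)
  obtain t where t: "t < length S" "x = S ! t"
    using assms(2) by (auto simp: in_set_conv_nth)
  have "S ! n = S ! 0"
    using assms n by (simp add: closed_curve_def)
  then have x: "x = S ! (t mod n)"
    using t n by (cases "t = n") auto
  let ?j = "(t + (n - i mod n)) mod n"
  have "i mod n \<le> n" using n by (intro less_imp_le) simp
  have "(i + ?j) mod n = (i mod n + (t + (n - i mod n))) mod n"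
    by (simp add: mod_simps)
  also have "\<dots> = t mod n"
    using \<open>i mod n \<le> n\<close> by (simp add: algebra_simps)
  finally have shift: "(i + ?j) mod n = t mod n" .
  show ?thesis
  proof (rule that[of ?j])
    show "?j < length S - 1" unfolding n_def[symmetric] using n by simp
    show "x = cyc S (i + ?j)" unfolding cyc_def n_def[symmetric] shift by (rule x)
  qed
qed

text \<open>The period is \<open>length S - 1\<close>, so the last index of the complementary arc is \<open>length S - 2\<close>.\<close>

lemma curve_minus_arc:
  assumes "closed_curve S"
  shows "set S - (\<lambda>j. cyc S (i + j)) ` {..k} = (\<lambda>j. cyc S (i + j)) ` {Suc k..length S - 2}"
proof -
  define n where "n = length S - 1"
  have n: "2 \<le> n" "length S - 2 = n - 1"
    using closed_curve_length[OF assms] by (auto simp: n_def)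
  have inj: "j = j'" if "cyc S (i + j) = cyc S (i + j')" "j < n" "j' < n" for j j'
  proof -
    have le: "j = j'" if "(i + j) mod n = (i + j') mod n" "j < n" "j' \<le> j" for j j'
    proof -
      have "n dvd (i + j) - (i + j')"
        using that mod_eq_dvd_iff_nat[of "i + j'" "i + j" n] by simp
      then have "n dvd j - j'" by simp
      then show ?thesis using that by (auto dest: dvd_imp_le)
    qed
    have "(i + j) mod n = (i + j') mod n"
      using that(1) by (simp add: cyc_eq_iff[OF assms] n_def)
    then show ?thesis
      using le[of j j'] le[of j' j] that by (cases "j' \<le> j") auto
  qed
  show ?thesis
  proof (intro subset_antisym subsetI)
    fix x assume x: "x \<in> set S - (\<lambda>j. cyc S (i + j)) ` {..k}"
    then obtain j where "j < n" "x = cyc S (i + j)"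
      using in_curve_cyc[OF assms, of x i] by (auto simp: n_def)
    moreover from this x have "\<not> j \<le> k" by auto
    ultimately show "x \<in> (\<lambda>j. cyc S (i + j)) ` {Suc k..length S - 2}"
      using n by auto
  next
    fix x assume "x \<in> (\<lambda>j. cyc S (i + j)) ` {Suc k..length S - 2}"
    then obtain j where j: "Suc k \<le> j" "j < n" "x = cyc S (i + j)"
      using n by auto
    then have "x \<noteq> cyc S (i + j')" if "j' \<le> k" for j'
      using inj[of j j'] that by auto
    then show "x \<in> set S - (\<lambda>j. cyc S (i + j)) ` {..k}"
      using j(3) cyc_in_set[OF assms] by auto
  qed
qed

lemma curve_minus_arc_connected:
  assumes "closed_curve S"
  shows "dconnected c2_adj (set S - (\<lambda>j. cyc S (i + j)) ` {..k})"
  unfolding curve_minus_arc[OF assms]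
proof (rule dconnected_chain[OF symp_adj(2)])
  show "c2_adj (cyc S (i + j)) (cyc S (i + Suc j))" for j
    using cyc_adj[OF assms, of "i + j"] by simp
qed

text \<open>The complement of \<open>S\<close> consists of \<open>F\<close> and \<open>I\<close> only, so the complement of \<open>X\<close> is the connected set
  \<open>I\<close>; a point of \<open>F\<close> next to \<open>I\<close> would merge the two components.\<close>

lemma bounding_curve_framed:
  assumes "bounding_curve S X"
  shows "framed X (set S)"
proof -
  obtain F I where cc: "closed_curve S" and comps: "dcomponents c1_adj (- set S) = {F, I}"
    and FI: "finite F" "infinite I" and X: "X = set S \<union> F"
    using assms by (auto simp: bounding_curve_def)
  have comp: "C = {y. linked c1_adj (- set S) x y}" if "C \<in> {F, I}" "x \<in> C" for C x
    using component_eq_linked[OF symp_adj(1)] that comps by blast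
  have sub: "F \<subseteq> - set S" "I \<subseteq> - set S" and conn: "dconnected c1_adj I"
    using comps by (auto simp: dcomponents_def)
  have cover: "x \<in> F \<union> I" if "x \<notin> set S" for x
  proof -
    have "{y. linked c1_adj (- set S) x y} \<in> {F, I}"
      using linked_class_is_component[OF symp_adj(1), of x "- set S"] that comps by simp
    moreover have "linked c1_adj (- set S) x x" by (simp add: linked_def)
    ultimately show ?thesis by auto
  qed
  have disj: "F \<inter> I = {}"
    using comp[of F] comp[of I] FI by blast
  have compl: "- X = I"
    using X cover disj sub by auto
  have "Bd X \<subseteq> set S"
  proof
    fix x assume "x \<in> Bd X"
    then obtain y where xy: "x \<in> X" "y \<notin> X" "c1_adj y x"
      unfolding Bd_def by blast
    show "x \<in> set S"
    proof (rule ccontr)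
      assume "x \<notin> set S"
      then have x: "x \<in> F" using xy X by auto
      have "linked c1_adj (- set S) x y"
      proof (rule linked_step)
        show "linked c1_adj (- set S) x x" by (simp add: linked_def)
        show "c1_adj x y" using xy(3) by (rule c1_adj_sym)
      qed (use xy(2) X \<open>x \<notin> set S\<close> in auto)
      then have "y \<in> F" using comp[of F x] x by blast
      then show False using xy X by auto
    qed
  qed
  moreover have "dconnected c2_adj (set S - {p})" "\<exists>q\<in>set S. c2_adj q p" if pS: "p \<in> set S" for p
  proof -
    obtain i where p: "p = cyc S i"
      using in_curve_cyc[OF cc pS, of 0] by auto
    show "dconnected c2_adj (set S - {p})"
      using curve_minus_arc_connected[OF cc, of i 0] p by simp
    show "\<exists>q\<in>set S. c2_adj q p"
      using cyc_adj[OF cc, of i] cyc_in_set[OF cc, of "Suc i"] c2_adj_sym p by blast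
  qed
  ultimately show ?thesis
    using X FI(1) conn compl by (auto simp: framed_def)
qed

section \<open>Edges of a convex disk\<close>

lemma curve_segment_arc:
  assumes "L \<in> curve_segments S"
  obtains i k where "L = (\<lambda>j. cyc S (i + j)) ` {..k}"
  using assms unfolding curve_segments_def cyc_def by blast

lemma curve_segment_subset:
  assumes "closed_curve S" "L \<in> curve_segments S"
  shows "L \<subseteq> set S"
proof -
  obtain i k where "L = (\<lambda>j. cyc S (i + j)) ` {..k}"
    using curve_segment_arc[OF assms(2)] by blast
  then show ?thesis using cyc_in_set[OF assms(1)] by auto
qed

lemma max_segmentD:
  assumes "L \<in> max_segments S"
  shows "L \<in> curve_segments S" "dconnected c2_adj L" "collinear (emb ` L)" "2 \<le> card L"
  using assms by (auto simp: max_segments_def curve_segments_def digital_segment_def)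

lemma extremal_coordinate_endpoint:
  fixes d :: "point \<Rightarrow> int"
  assumes cd: "d = fst \<or> d = snd" and "p \<in> L" "inj_on d L"
    and ext: "(\<forall>q\<in>L. d p \<le> d q) \<or> (\<forall>q\<in>L. d q \<le> d p)"
  shows "p \<in> segment_endpoints L"
proof -
  have "emb p \<notin> open_segment (emb q) (emb r)" if qr: "q \<in> L" "r \<in> L" for q r
  proof
    assume seg: "emb p \<in> open_segment (emb q) (emb r)"
    then have "q \<noteq> r" by auto
    then have ne: "d q \<noteq> d r" using qr assms(3) by (auto dest: inj_onD)
    have "real_of_int (d p) \<in> open_segment (real_of_int (d q)) (real_of_int (d r))"
      using cd
    proof
      assume "d = fst"
      then show ?thesis
        using in_open_segment_imp_Re_in_open_segment[OF seg] ne by (simp add: emb_def)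
    next
      assume "d = snd"
      then show ?thesis
        using in_open_segment_imp_Im_in_open_segment[OF seg] ne by (simp add: emb_def)
    qed
    then have "d q < d p \<and> d p < d r \<or> d r < d p \<and> d p < d q"
      using ne by (auto simp: open_segment_eq_real_ivl split: if_splits)
    then show False using ext qr by force
  qed
  then show ?thesis
    using assms(2) by (auto simp: segment_endpoints_def)
qed

lemma axis_between:
  fixes c d :: "point \<Rightarrow> int"
  assumes cd: "c = snd \<and> d = fst \<or> c = fst \<and> d = snd"
    and "c v = c u" "c w = c u" "d u < d v" "d v < d w"
  shows "emb v \<in> open_segment (emb u) (emb w)"
proof -
  define t where "t = (d v - d u) / real_of_int (d w - d u)"
  have t: "0 < t" "t < 1" "t * (d w - d u) = d v - d u"
    using assms(4,5) by (auto simp: t_def field_simps)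
  have "emb u \<noteq> emb w"
    using cd assms(4,5) by (auto simp: emb_def)
  moreover have "emb v = (1 - t) *\<^sub>R emb u + t *\<^sub>R emb w"
    using cd assms(2,3) t(3) by (auto simp: emb_def complex_eq_iff algebra_simps)
  ultimately show ?thesis
    using t(1,2) unfolding in_segment by blast
qed

lemma convex_endpoint_extreme:
  assumes "convex_wrt X S" "L \<in> max_segments S" "p \<in> segment_endpoints L"
  shows "emb p extreme_point_of (convex hull (emb ` X))"
  using assms unfolding convex_wrt_def by blast

lemma axis_edge_inj:
  fixes c d :: "point \<Rightarrow> int"
  assumes cd: "c = snd \<and> d = fst \<or> c = fst \<and> d = snd"
    and const: "\<And>q. q \<in> L \<Longrightarrow> c q = t"
  shows "inj_on d L"
proof (rule inj_onI)
  fix x y assume "x \<in> L" "y \<in> L" "d x = d y"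
  moreover from this have "c x = c y" using const[of x] const[of y] by simp
  ultimately show "x = y" using cd by (auto simp: prod_eq_iff)
qed

text \<open>Both ends of a horizontal or vertical edge are vertices of the hull, so the hull meets the line of the edge
  exactly in the edge. Here \<open>c\<close> is the coordinate that is constant on the edge and \<open>d\<close> is the other one.\<close>

lemma axis_edge_full:
  fixes c d :: "point \<Rightarrow> int"
  assumes conv: "convex_wrt X S" and L: "L \<in> max_segments S"
    and cd: "c = snd \<and> d = fst \<or> c = fst \<and> d = snd"
    and const: "\<And>q. q \<in> L \<Longrightarrow> c q = t" and w: "w \<in> set S" "c w = t"
  shows "w \<in> L"
proof -
  have cc: "closed_curve S" and SX: "set S \<subseteq> X"
    using conv by (auto simp: convex_wrt_def bounding_curve_def)
  note seg = max_segmentD[OF L]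
  have LS: "L \<subseteq> set S" by (rule curve_segment_subset[OF cc seg(1)])
  have fin: "finite L" and ne: "L \<noteq> {}"
    using seg(4) by (auto intro: card_ge_0_finite)
  have inj: "inj_on d L" by (rule axis_edge_inj[OF cd const])
  obtain u v where u: "u \<in> L" "\<And>q. q \<in> L \<Longrightarrow> d u \<le> d q"
    and v: "v \<in> L" "\<And>q. q \<in> L \<Longrightarrow> d q \<le> d v"
    using finite_coordinate_extrema[OF fin ne, of d] by blast
  have uv: "d u < d v"
  proof (rule ccontr)
    assume "\<not> d u < d v"
    then have "d q = d u" if "q \<in> L" for q using that u(2) v(2) by fastforce
    then have "L = {u}" using inj u(1) by (auto dest: inj_onD)
    then show False using seg(4) by simp
  qed
  have hull: "emb q \<in> convex hull (emb ` X)" if "q \<in> set S" for q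
    using that SX by (intro hull_inc) auto
  have "u \<in> segment_endpoints L" "v \<in> segment_endpoints L"
    using cd u v inj by (auto intro!: extremal_coordinate_endpoint[of d])
  then have ext: "emb u extreme_point_of (convex hull (emb ` X))"
    "emb v extreme_point_of (convex hull (emb ` X))"
    using convex_endpoint_extreme[OF conv L] by auto
  have inS: "u \<in> set S" "v \<in> set S" using u(1) v(1) LS by auto
  have "\<not> d w < d u"
    using ext(1) axis_between[OF cd, of u w v] uv const[OF u(1)] const[OF v(1)] w
      hull[OF w(1)] hull[OF inS(2)] unfolding extreme_point_of_def by auto
  moreover have "\<not> d v < d w"
    using ext(2) axis_between[OF cd, of v u w] uv const[OF u(1)] const[OF v(1)] w
      hull[OF w(1)] hull[OF inS(1)] unfolding extreme_point_of_def by auto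
  ultimately obtain q where "q \<in> L" "d q = d w"
    using connected_hits_value[OF seg(2), of d u v "d w"] u(1) v(1) cd
    by (auto simp: c2_adj_def not_less)
  moreover from this have "c q = c w" using const w by simp
  ultimately have "q = w" using cd by (auto simp: prod_eq_iff)
  with \<open>q \<in> L\<close> show ?thesis by simp
qed

text \<open>The rest of the curve is connected and, by \<open>axis_edge_full\<close>, avoids the line of the edge. Steps
  cannot jump over a horizontal or vertical lattice line, so it stays on one side. (Slanted lines
  can be jumped over, and slanted edges may indeed be chords of the hull.)\<close>

lemma axis_edge_supports:
  fixes c d :: "point \<Rightarrow> int"
  assumes conv: "convex_wrt X S" and L: "L \<in> max_segments S"
    and cd: "c = snd \<and> d = fst \<or> c = fst \<and> d = snd"
    and const: "\<And>q. q \<in> L \<Longrightarrow> c q = t"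
  shows "(\<forall>w\<in>set S. t \<le> c w) \<or> (\<forall>w\<in>set S. c w \<le> t)"
proof (rule ccontr)
  assume "\<not> ?thesis"
  then obtain v w where vw: "v \<in> set S" "w \<in> set S" "c v < t" "t < c w"
    by (auto simp: not_le)
  have cc: "closed_curve S" using conv by (auto simp: convex_wrt_def bounding_curve_def)
  have "dconnected c2_adj (set S - L)"
    using max_segmentD(1)[OF L] curve_minus_arc_connected[OF cc] by (metis curve_segment_arc)
  moreover have "v \<in> set S - L" "w \<in> set S - L"
    using vw const[of v] const[of w] by auto
  ultimately obtain q where "q \<in> set S - L" "c q = t"
    using connected_hits_value[of "set S - L" c v w t] vw cd by (auto simp: c2_adj_def)
  then show False
    using axis_edge_full[OF conv L cd const, of q] by auto
qed

text \<open>At the ends of the edge this is the case of a hull vertex; between them, both neighbours on the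
  edge are available for \<open>framed_point_above\<close>.\<close>

lemma axis_edge_foldable:
  fixes c d :: "point \<Rightarrow> int"
  assumes conv: "convex_wrt X S" and L: "L \<in> max_segments S"
    and cd: "c = snd \<and> d = fst \<or> c = fst \<and> d = snd"
    and const: "\<And>q. q \<in> L \<Longrightarrow> c q = c p" and p: "p \<in> L"
  shows "foldable X p"
proof -
  have fr: "framed X (set S)" and LS: "L \<subseteq> set S" and SX: "set S \<subseteq> X"
    using conv bounding_curve_framed curve_segment_subset[OF _ max_segmentD(1)[OF L]]
    by (auto simp: convex_wrt_def bounding_curve_def)
  show ?thesis
  proof (cases "(\<forall>q\<in>L. d p \<le> d q) \<or> (\<forall>q\<in>L. d q \<le> d p)")
    case True
    have "inj_on d L" by (rule axis_edge_inj[OF cd const])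
    then have "p \<in> segment_endpoints L"
      using True cd p by (intro extremal_coordinate_endpoint[of d]) auto
    then have "emb p extreme_point_of (convex hull (emb ` X))"
      by (rule convex_endpoint_extreme[OF conv L])
    then show ?thesis
      using foldable_extreme[OF fr _] p LS SX by blast
  next
    case False
    then obtain q r where "q \<in> L" "r \<in> L" "d q < d p" "d p < d r"
      by (auto simp: not_le)
    then obtain q' r' where qr: "q' \<in> L" "d q' = d p - 1" "r' \<in> L" "d r' = d p + 1"
      using connected_hits_value[OF max_segmentD(2)[OF L], of d q p "d p - 1"]
        connected_hits_value[OF max_segmentD(2)[OF L], of d p r "d p + 1"] p cd
      by (auto simp: c2_adj_def)
    have inS: "p \<in> set S" "q' \<in> set S" "r' \<in> set S"
      using qr p LS by auto
    note side = axis_edge_supports[OF conv L cd const]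
    from cd show ?thesis
    proof
      assume cd': "c = snd \<and> d = fst"
      then have "q' = (fst p - 1, snd p)" "r' = (fst p + 1, snd p)"
        using qr const[of q'] const[of r'] by (auto simp: prod_eq_iff)
      then show ?thesis
        using foldable_horizontal_edge[OF fr] inS side cd' by simp
    next
      assume cd': "c = fst \<and> d = snd"
      then have "q' = (fst p, snd p - 1)" "r' = (fst p, snd p + 1)"
        using qr const[of q'] const[of r'] by (auto simp: prod_eq_iff)
      then show ?thesis
        using foldable_vertical_edge[OF fr] inS side cd' by simp
    qed
  qed
qed

section \<open>Continuous maps fixing the frame\<close>

lemma continuous_coordinates:
  assumes "f \<in> dcontinuous_maps X c2_adj" "u \<in> X" "v \<in> X" "c2_adj u v"
  shows "\<bar>fst (f u) - fst (f v)\<bar> \<le> 1 \<and> \<bar>snd (f u) - snd (f v)\<bar> \<le> 1"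
proof -
  have "dconnected c2_adj {u, v}"
    using assms(4) c2_adj_sym by (intro dconnected_pair)
  moreover have "dconnected c2_adj (f ` A)" if "A \<subseteq> X" "dconnected c2_adj A" for A
    using assms(1) that by (simp add: dcontinuous_maps_def)
  ultimately have "dconnected c2_adj (f ` {u, v})"
    using assms(2,3) by (metis empty_subsetI insert_subset)
  then have "f u = f v \<or> c2_adj (f u) (f v)"
    using pair_connected_adj[of c2_adj "f u" "f v"] by auto
  then show ?thesis by (auto simp: c2_adj_def)
qed

text \<open>Stepping from \<open>x\<close> against the direction \<open>(d1, d2)\<close> reaches a boundary point after some \<open>k\<close> steps. That point is
  fixed, so \<open>f x\<close> lies at most \<open>k\<close> beyond it in direction \<open>(d1, d2)\<close>, which is no farther than \<open>x\<close>.\<close>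

lemma fixed_boundary_bound:
  fixes d1 d2 :: int
  assumes f: "f \<in> dcontinuous_maps X c2_adj" and fin: "finite X"
    and fixed: "\<And>x. x \<in> Bd X \<Longrightarrow> f x = x"
    and d: "(d1, d2) \<in> {(1, 0), (-1, 0), (0, 1), (0, -1)}" and "x \<in> X"
  shows "d1 * fst (f x) + d2 * snd (f x) \<le> d1 * fst x + d2 * snd x"
proof -
  define g where "g = (\<lambda>x :: point. d1 * fst x + d2 * snd x)"
  have low: "Min (g ` X) \<le> g x" if "x \<in> X" for x
    using that fin by simp
  have "g (f x) \<le> g x" using \<open>x \<in> X\<close>
  proof (induction "nat (g x - Min (g ` X))" arbitrary: x rule: less_induct)
    case less
    define y where "y = (fst x - d1, snd x - d2)"
    have gy: "g y = g x - 1" and adj: "c1_adj y x" "c2_adj y x"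
      using d by (auto simp: g_def y_def c1_adj_def c2_adj_def prod_eq_iff)
    show ?case
    proof (cases "y \<in> X")
      case True
      have "g (f y) \<le> g y"
        using low[OF True] gy True by (intro less(1)) auto
      moreover have "g (f x) \<le> g (f y) + 1"
        using continuous_coordinates[OF f True less(2) adj(2)] d by (auto simp: g_def)
      ultimately show ?thesis using gy by simp
    next
      case False
      then show ?thesis using fixed[OF BdI[OF less(2) False adj(1)]] by simp
    qed
  qed
  then show ?thesis by (simp add: g_def)
qed

lemma fixed_boundary_imp_identity:
  assumes f: "f \<in> dcontinuous_maps X c2_adj" and fin: "finite X"
    and fixed: "\<And>x. x \<in> Bd X \<Longrightarrow> f x = x" and "x \<in> X"
  shows "f x = x"
  using fixed_boundary_bound[OF f fin fixed, of 1 0 x] fixed_boundary_bound[OF f fin fixed, of "-1" 0 x]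
    fixed_boundary_bound[OF f fin fixed, of 0 1 x] fixed_boundary_bound[OF f fin fixed, of 0 "-1" x]
    assms(4)
  by (simp add: prod_eq_iff)

lemma slanted_inj: "slanted L \<Longrightarrow> inj_on fst L"
  unfolding inj_on_def slanted_def prod_eq_iff by fastforce

text \<open>Moving along a slanted segment, each unit of the first coordinate is one step.\<close>

lemma slanted_displacement:
  assumes f: "f \<in> dcontinuous_maps X c2_adj" and LX: "L \<subseteq> X" and conn: "dconnected c2_adj L"
    and sl: "slanted L" and u: "u \<in> L" and "p \<in> L" "fst u \<le> fst p"
  shows "\<bar>fst (f p) - fst (f u)\<bar> \<le> fst p - fst u \<and> \<bar>snd (f p) - snd (f u)\<bar> \<le> fst p - fst u"
  using assms(6,7)
proof (induction "nat (fst p - fst u)" arbitrary: p)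
  case 0
  then have "p = u" using slanted_inj[OF sl] u by (auto dest: inj_onD)
  then show ?case by simp
next
  case (Suc n)
  then have "fst u \<le> fst p - 1" by simp
  then have "\<exists>q\<in>L. fst q = fst p - 1"
    using connected_hits_value[OF conn, of fst u p "fst p - 1"] u Suc(3) by (simp add: c2_adj_def)
  then obtain q where q: "q \<in> L" "fst q = fst p - 1" by blast
  have "\<bar>snd p - snd q\<bar> \<le> 1"
    using sl q Suc(3) unfolding slanted_def by fastforce
  then have "c2_adj q p" using q by (auto simp: c2_adj_def)
  then have "\<bar>fst (f q) - fst (f p)\<bar> \<le> 1 \<and> \<bar>snd (f q) - snd (f p)\<bar> \<le> 1"
    using continuous_coordinates[OF f] q(1) Suc(3) LX by blast
  moreover have "\<bar>fst (f q) - fst (f u)\<bar> \<le> fst q - fst u \<and> \<bar>snd (f q) - snd (f u)\<bar> \<le> fst q - fst u"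
    using Suc(2) q by (intro Suc(1)) auto
  ultimately show ?case using q(2) by auto
qed

text \<open>Between the two ends \<open>u\<close> and \<open>v\<close> both coordinates change by exactly the number of steps, so a point that is
  within its step distance of both ends has no freedom left.\<close>

lemma slanted_fixed:
  assumes f: "f \<in> dcontinuous_maps X c2_adj" and LX: "L \<subseteq> X" and conn: "dconnected c2_adj L"
    and sl: "slanted L" and fin: "finite L" and fixed: "\<And>x. x \<in> segment_endpoints L \<Longrightarrow> f x = x"
    and p: "p \<in> L"
  shows "f p = p"
proof -
  have ne: "L \<noteq> {}" using p by auto
  have inj: "inj_on fst L" by (rule slanted_inj[OF sl])
  obtain u v where u: "u \<in> L" "\<And>q. q \<in> L \<Longrightarrow> fst u \<le> fst q"
    and v: "v \<in> L" "\<And>q. q \<in> L \<Longrightarrow> fst q \<le> fst v"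
    using finite_coordinate_extrema[OF fin ne, of fst] by blast
  have "u \<in> segment_endpoints L"
    by (rule extremal_coordinate_endpoint[of fst]) (use u inj in blast)+
  moreover have "v \<in> segment_endpoints L"
    by (rule extremal_coordinate_endpoint[of fst]) (use v inj in blast)+
  ultimately have fix_uv: "f u = u" "f v = v"
    using fixed by blast+
  have near: "\<bar>fst (f p) - fst u\<bar> \<le> fst p - fst u" "\<bar>snd (f p) - snd u\<bar> \<le> fst p - fst u"
    "\<bar>fst v - fst (f p)\<bar> \<le> fst v - fst p" "\<bar>snd v - snd (f p)\<bar> \<le> fst v - fst p"
    using slanted_displacement[OF f LX conn sl u(1) p u(2)[OF p]]
      slanted_displacement[OF f LX conn sl p v(1) v(2)[OF p]] fix_uv by auto
  have "snd p - snd u = fst p - fst u \<and> snd v - snd u = fst v - fst u \<or>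
      snd p - snd u = - (fst p - fst u) \<and> snd v - snd u = - (fst v - fst u)"
    using sl u(1) v(1) p unfolding slanted_def by blast
  then show ?thesis
    using near by (auto simp: prod_eq_iff)
qed

lemma adjacent_collinear_direction:
  assumes "collinear (emb ` L)" "a \<in> L" "b \<in> L" "c2_adj a b"
  shows "horizontal L \<or> vertical L \<or> slanted L"
proof -
  obtain e where e: "\<And>x y. x \<in> L \<Longrightarrow> y \<in> L \<Longrightarrow> \<exists>c. emb x - emb y = c *\<^sub>R e"
    using assms(1) unfolding collinear_def by auto
  obtain c0 where c0: "emb b - emb a = c0 *\<^sub>R e" using e assms by blast
  have "emb b \<noteq> emb a"
    using assms(4) by (auto simp: c2_adj_def emb_def prod_eq_iff)
  then have c0': "c0 \<noteq> 0" using c0 by auto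
  have par: "\<exists>r. real_of_int (fst x - fst y) = r * real_of_int (fst b - fst a)
      \<and> real_of_int (snd x - snd y) = r * real_of_int (snd b - snd a)"
    if xy: "x \<in> L" "y \<in> L" for x y
  proof -
    obtain c where c: "emb x - emb y = c *\<^sub>R e" using e xy by blast
    have "emb x - emb y = (c / c0) *\<^sub>R (emb b - emb a)"
      using c c0 c0' by simp
    then show ?thesis
      by (intro exI[of _ "c / c0"]) (simp add: emb_def complex_eq_iff)
  qed
  define i j where "i = fst b - fst a" and "j = snd b - snd a"
  have ij: "i \<in> {-1, 0, 1}" "j \<in> {-1, 0, 1}" "\<not> (i = 0 \<and> j = 0)"
    using assms(4) by (auto simp: i_def j_def c2_adj_def prod_eq_iff)
  note par = par[folded i_def j_def]
  consider "j = 0" | "i = 0" | "i = j" | "j = - i" using ij by auto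
  then show ?thesis
  proof cases
    case 1
    then have "horizontal L" unfolding horizontal_def using par by fastforce
    then show ?thesis by simp
  next
    case 2
    then have "vertical L" unfolding vertical_def using par by fastforce
    then show ?thesis by simp
  next
    case 3
    have "snd x - snd y = fst x - fst y" if "x \<in> L" "y \<in> L" for x y
      using par[OF that] 3 by (metis of_int_eq_iff)
    then show ?thesis unfolding slanted_def by blast
  next
    case 4
    have "snd x - snd y = - (fst x - fst y)" if xy: "x \<in> L" "y \<in> L" for x y
    proof -
      obtain r where "real_of_int (fst x - fst y) = r * real_of_int i" "real_of_int (snd x - snd y) = r * real_of_int j"
        using par[OF xy] by blast
      then have "real_of_int (snd x - snd y) = real_of_int (- (fst x - fst y))" using 4 by simp
      then show ?thesis by (simp only: of_int_eq_iff)
    qed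
    then show ?thesis unfolding slanted_def by blast
  qed
qed

text \<open>Two consecutive points of the curve form a segment, and a maximal segment containing it is parallel
  to that step.\<close>

lemma curve_point_in_edge:
  assumes cc: "closed_curve S" and "x \<in> set S"
  obtains L where "L \<in> max_segments S" "x \<in> L" "horizontal L \<or> vertical L \<or> slanted L"
proof -
  obtain i where i: "x = cyc S i"
    using in_curve_cyc[OF assms, of 0] by auto
  define y where "y = cyc S (Suc i)"
  have adj: "c2_adj x y" using cyc_adj[OF cc] i y_def by simp
  have "dconnected c2_adj {x, y}"
    using adj c2_adj_sym by (intro dconnected_pair)
  moreover have "card {x, y} = 2" using adj by (simp add: c2_adj_def)
  moreover have "collinear (emb ` {x, y})" by simp
  moreover have "\<exists>i k. {x, y} = (\<lambda>j. S ! ((i + j) mod (length S - 1))) ` {..k}"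
    by (intro exI[of _ i] exI[of _ 1]) (auto simp: i y_def cyc_def atMost_Suc)
  ultimately have "{x, y} \<in> curve_segments S"
    unfolding curve_segments_def digital_segment_def by simp
  moreover have "curve_segments S \<subseteq> Pow (set S)"
    using curve_segment_subset[OF cc] by blast
  then have "finite (curve_segments S)"
    by (rule finite_subset) simp
  ultimately have "\<exists>L\<in>curve_segments S. {x, y} \<subseteq> L \<and> (\<forall>L'\<in>curve_segments S. L \<subseteq> L' \<longrightarrow> L = L')"
    by (intro finite_has_maximal2)
  then obtain L where L: "L \<in> curve_segments S" "{x, y} \<subseteq> L"
    "\<forall>L'\<in>curve_segments S. L \<subseteq> L' \<longrightarrow> L = L'"
    by blast
  have max: "L \<in> max_segments S"
    using L(1,3) unfolding max_segments_def by blast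
  have "x \<in> L" "y \<in> L" using L(2) by auto
  then show ?thesis
    using that[OF max] adjacent_collinear_direction[OF max_segmentD(3)[OF max] _ _ adj] by blast
qed

section \<open>Edges and vertices as a minimal freezing set\<close>

theorem theorem4p3:
  fixes X :: "point set" and S :: "point list" and B1 B2 B :: "point set"
  assumes "digital_disk X"
    and "bounding_curve S X"
    and "convex_wrt X S"
    and "thick_wrt X S"
    and "B1 = {x \<in> set S. \<exists>L \<in> max_segments S. slanted L \<and> x \<in> segment_endpoints L}"
    and "B2 = \<Union> {L \<in> max_segments S. horizontal L \<or> vertical L}"
    and "B = B1 \<union> B2"
  shows "minimal_freezing_set X c2_adj B"
proof -
  have cc: "closed_curve S" and SX: "set S \<subseteq> X"
    using assms(2) by (auto simp: bounding_curve_def)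
  have fr: "framed X (set S)" by (rule bounding_curve_framed[OF assms(2)])
  have sub: "L \<subseteq> set S" if "L \<in> max_segments S" for L
    using curve_segment_subset[OF cc max_segmentD(1)[OF that]] .
  have BS: "B \<subseteq> set S"
    using sub assms(5-7) by blast
  have "freezing_set X c2_adj B"
    unfolding freezing_set_def
  proof (intro conjI ballI impI)
    show "B \<subseteq> X" using BS SX by simp
    fix f x assume f: "f \<in> dcontinuous_maps X c2_adj" and fixB: "B \<subseteq> Fix_on X f" and x: "x \<in> X"
    have fixS: "f y = y" if y: "y \<in> set S" for y
    proof -
      obtain L where L: "L \<in> max_segments S" "y \<in> L" and dir: "horizontal L \<or> vertical L \<or> slanted L"
        using curve_point_in_edge[OF cc y] .
      show ?thesis
      proof (cases "horizontal L \<or> vertical L")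
        case True
        then have "y \<in> B" using L assms(6,7) by blast
        then show ?thesis using fixB by (auto simp: Fix_on_def)
      next
        case False
        then have sl: "slanted L" using dir by simp
        have "segment_endpoints L \<subseteq> B"
          using L(1) sl sub[OF L(1)] assms(5,7) by (auto simp: segment_endpoints_def)
        then have "f z = z" if "z \<in> segment_endpoints L" for z
          using that fixB by (auto simp: Fix_on_def)
        moreover have "L \<subseteq> X" "finite L"
          using sub[OF L(1)] SX finite_subset by auto
        ultimately show ?thesis
          using slanted_fixed[OF f _ max_segmentD(2)[OF L(1)] sl] L(2) by blast
      qed
    qed
    show "f x = x"
      using fr fixS by (intro fixed_boundary_imp_identity[OF f _ _ x]) (auto simp: framed_def)
  qed
  moreover have "\<not> freezing_set X c2_adj A" if AB: "A \<subset> B" for A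
  proof -
    obtain p where p: "p \<in> B" "p \<notin> A" using AB by blast
    have pX: "p \<in> X" using p(1) BS SX by blast
    have "foldable X p"
    proof (cases "p \<in> B1")
      case True
      then obtain L where "L \<in> max_segments S" "p \<in> segment_endpoints L"
        using assms(5) by blast
      then show ?thesis
        using foldable_extreme[OF fr pX] convex_endpoint_extreme[OF assms(3)] by blast
    next
      case False
      then obtain L where L: "L \<in> max_segments S" "horizontal L \<or> vertical L" "p \<in> L"
        using p(1) assms(6,7) by blast
      from L(2) show ?thesis
      proof
        assume "horizontal L"
        then have const: "snd q = snd p" if "q \<in> L" for q
          using L(3) that unfolding horizontal_def by blast
        show ?thesis
          by (rule axis_edge_foldable[where c = snd and d = fst, OF assms(3) L(1) _ const L(3)]) simp
      next
        assume "vertical L"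
        then have const: "fst q = fst p" if "q \<in> L" for q
          using L(3) that unfolding vertical_def by blast
        show ?thesis
          by (rule axis_edge_foldable[where c = fst and d = snd, OF assms(3) L(1) _ const L(3)]) simp
      qed
    qed
    then show ?thesis using foldable_not_freezing pX p(2) by blast
  qed
  ultimately show ?thesis by (simp add: minimal_freezing_set_def)
qed

end
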